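(* Let $\mathcal{G}$ and $\mathcal{I}$ be finite disjoint index sets, let $\alpha_{\mathrm{t},i}>0$ and $\tau_i>0$ be real numbers for $i\in\mathcal{G}$, and let $\rho_i\ge 0$ and $\sigma_i>0$ be real numbers for $i\in\mathcal{I}$. Write $\boldsymbol{\rho}=(\rho_i)_{i\in\mathcal{I}}\in\mathbb{R}^{|\mathcal{I}|}$ and $\boldsymbol{\sigma}=(\sigma_i)_{i\in\mathcal{I}}\in\mathbb{R}^{|\mathcal{I}|}$. Define $\boldsymbol{\Sigma}(\boldsymbol{\sigma})\in\mathbb{R}^{|\mathcal{I}|\times|\mathcal{I}|}$, $\boldsymbol{b}(\boldsymbol{\sigma})\in\mathbb{R}^{|\mathcal{I}|}$ and $c\in\mathbb{R}$ by $$\Sigma_{ij}=\frac{1}{\sigma_i+\sigma_j}\ (i,j\in\mathcal{I}),\qquad b_i=-2\sum_{j\in\mathcal{G}}\frac{\alpha_{\mathrm{t},j}}{\sigma_i+\tau_j}\ (i\in\mathcal{I}),\qquad c=\sum_{i\in\mathcal{G}}\sum_{j\in\mathcal{G}}\frac{\alpha_{\mathrm{t},i}\alpha_{\mathrm{t},j}}{\tau_i+\tau_j}.$$ Then $\boldsymbol{\Sigma}(\boldsymbol{\sigma})$ is positive semi-definite, and the identity $$\sum_{i\in\mathcal{I}}\frac{\rho_i}{\sigma_i s+1}=\sum_{i\in\mathcal{G}}\frac{\alpha_{\mathrm{t},i}}{\tau_i s+1}$$ holds (for all $s$, i.e. as an identity of rational functions of $s$) if and only if $$\boldsymbol{\r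ho}^T\boldsymbol{\Sigma}(\boldsymbol{\sigma})\boldsymbol{\rho}+\boldsymbol{b}(\boldsymbol{\sigma})^T\boldsymbol{\rho}+c=0.$$
   Context: In the application, $\mathcal{G}$ indexes synchronous generators with turbine inverse droop coefficients $\alpha_{\mathrm{t},i}$ and turbine time constants $\tau_i$, and $\mathcal{I}$ indexes grid-forming inverters with tunable controller parameters $\rho_i,\sigma_i$. The variable $s$ is the complex Laplace variable. Positive semi-definite means symmetric with $\boldsymbol{x}^T\boldsymbol{\Sigma}(\boldsymbol{\sigma})\boldsymbol{x}\ge 0$ for all $\boldsymbol{x}\in\mathbb{R}^{|\mathcal{I}|}$. *)

theory Defs
  imports Complex_Main "HOL-Computational_Algebra.Polynomial" "HOL-Computational_Algebra.Fraction_Field"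
begin

text \<open>
  A vector indexed by a finite set \<open>I\<close> is a function of which only the values on \<open>I\<close> matter,
  and likewise for matrices. Index sets may thus be empty, which types of class finite
  would rule out.
\<close>

definition inner_on :: "'a set \<Rightarrow> ('a \<Rightarrow> real) \<Rightarrow> ('a \<Rightarrow> real) \<Rightarrow> real" where
  "inner_on I x y = (\<Sum>i\<in>I. x i * y i)"

definition mult_vec_on :: "'a set \<Rightarrow> ('a \<Rightarrow> 'a \<Rightarrow> real) \<Rightarrow> ('a \<Rightarrow> real) \<Rightarrow> 'a \<Rightarrow> real" where
  "mult_vec_on I M x i = (\<Sum>j\<in>I. M i j * x j)"

definition pos_semidef_on :: "'a set \<Rightarrow> ('a \<Rightarrow> 'a \<Rightarrow> real) \<Rightarrow> bool" where
  "pos_semidef_on I M \<longleftrightarrow>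
     (\<forall>i\<in>I. \<forall>j\<in>I. M i j = M j i) \<and> (\<forall>x. inner_on I x (mult_vec_on I M x) \<ge> 0)"

definition Sigma_mat :: "('a \<Rightarrow> real) \<Rightarrow> 'a \<Rightarrow> 'a \<Rightarrow> real" where
  "Sigma_mat \<sigma> i j = 1 / (\<sigma> i + \<sigma> j)"

definition b_vec :: "'a set \<Rightarrow> ('a \<Rightarrow> real) \<Rightarrow> ('a \<Rightarrow> real) \<Rightarrow> ('a \<Rightarrow> real) \<Rightarrow> 'a \<Rightarrow> real" where
  "b_vec G \<alpha> \<tau> \<sigma> i = - 2 * (\<Sum>j\<in>G. \<alpha> j / (\<sigma> i + \<tau> j))"

definition c_const :: "'a set \<Rightarrow> ('a \<Rightarrow> real) \<Rightarrow> ('a \<Rightarrow> real) \<Rightarrow> real" where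
  "c_const G \<alpha> \<tau> = (\<Sum>i\<in>G. \<Sum>j\<in>G. \<alpha> i * \<alpha> j / (\<tau> i + \<tau> j))"

text \<open>
  The sum of \<open>k i / (t i * s + 1)\<close> over \<open>i\<close> in \<open>A\<close>, once as an element of the field of
  rational functions over the reals, with \<open>s\<close> the indeterminate, and once evaluated at a
  complex number \<open>s\<close>. In the first, \<open>[:1, t i:]\<close> is the polynomial \<open>1 + t i * s\<close>, which is
  never zero. The second is meaningful only where no denominator vanishes, since
  \<open>x / 0 = 0\<close> in HOL.
\<close>

definition lag_sum_fract :: "'a set \<Rightarrow> ('a \<Rightarrow> real) \<Rightarrow> ('a \<Rightarrow> real) \<Rightarrow> real poly fract" where
  "lag_sum_fract A k t = (\<Sum>i\<in>A. Fract [:k i:] [:1, t i:])"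

definition lag_sum :: "'a set \<Rightarrow> ('a \<Rightarrow> real) \<Rightarrow> ('a \<Rightarrow> real) \<Rightarrow> complex \<Rightarrow> complex" where
  "lag_sum A k t s = (\<Sum>i\<in>A. of_real (k i) / (of_real (t i) * s + 1))"

definition no_pole :: "'a set \<Rightarrow> ('a \<Rightarrow> real) \<Rightarrow> complex \<Rightarrow> bool" where
  "no_pole A t s \<longleftrightarrow> (\<forall>i\<in>A. of_real (t i) * s + 1 \<noteq> 0)"

end

theory Submission
  imports Defs
begin

text \<open>
  Put \<open>K = I \<union> G\<close> and let \<open>x\<close> be \<open>\<rho>\<close> on \<open>I\<close> and \<open>-\<alpha>\<close> on \<open>G\<close>, with time constants \<open>t\<close>.
  The quadratic expression is then the Cauchy form \<open>Q x = \<Sum> x i * x j / (t i + t j)\<close>, and the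
  identity of transfer functions says that \<open>F x s = \<Sum> x i / (t i * s + 1)\<close> vanishes.
  Taking the Schur complement at \<open>k \<in> K\<close> and writing \<open>y i = x i * (t i - t k) / (t i + t k)\<close>
  and \<open>d = \<Sum> x i / (t i + t k)\<close> gives
  \<open>Q x = 2 * t k * d\<^sup>2 + Q y\<close> and
  \<open>F x s = 2 * t k * d / (t k * s + 1) + (1 - t k * s) / (1 + t k * s) * F y s\<close>.
  Since \<open>y k = 0\<close>, induction on \<open>K\<close> shows that \<open>Q\<close> is nonnegative and that \<open>Q x = 0\<close> forces
  \<open>F x = 0\<close>, without separating coinciding time constants. The converse is
  \<open>Q x = \<Sum> x k / t k * F x (1 / t k)\<close>.
\<close>

section \<open>Cauchy forms: Schur complement and nonnegativity\<close>

definition cauchy_form :: "'a set \<Rightarrow> ('a \<Rightarrow> real) \<Rightarrow> ('a \<Rightarrow> real) \<Rightarrow> real" where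
  "cauchy_form K t x = (\<Sum>i\<in>K. \<Sum>j\<in>K. x i * x j / (t i + t j))"

text \<open>For positive time constants, the factor multiplying \<open>x i\<close> is the value at
  \<open>s = 1 / t i\<close> of \<open>(1 - t k * s) / (1 + t k * s)\<close>, the Blaschke factor of
  the right half-plane with its zero at \<open>1 / t k\<close>.\<close>

definition blaschke_weight :: "('a \<Rightarrow> real) \<Rightarrow> 'a \<Rightarrow> ('a \<Rightarrow> real) \<Rightarrow> 'a \<Rightarrow> real" where
  "blaschke_weight t k x i = x i * (t i - t k) / (t i + t k)"

lemma blaschke_weight_self [simp]: "blaschke_weight t k x k = 0"
  by (simp add: blaschke_weight_def)

text \<open>One entry of the elimination with pivot \<open>1 / (2 * c)\<close>. Clearing
  denominators leaves
  \<open>(a + c) * (b + c) - 2 * c * (a + b) = (a - c) * (b - c)\<close>.\<close>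

lemma schur_term:
  fixes a b c u v :: real
  assumes "a > 0" "b > 0" "c > 0"
  shows "u * v / (a + b) =
    2 * c * (u / (a + c) * (v / (b + c))) +
    (u * (a - c) / (a + c)) * (v * (b - c) / (b + c)) / (a + b)"
proof -
  have "a + b \<noteq> 0" "a + c \<noteq> 0" "b + c \<noteq> 0"
    using assms by auto
  then show ?thesis
    by (simp add: divide_simps) algebra
qed

lemma cauchy_form_schur:
  assumes "k \<in> K" "\<And>i. i \<in> K \<Longrightarrow> t i > 0"
  shows "cauchy_form K t x =
    2 * t k * (\<Sum>i\<in>K. x i / (t i + t k))\<^sup>2 + cauchy_form K t (blaschke_weight t k x)"
proof -
  have "cauchy_form K t x = (\<Sum>i\<in>K. \<Sum>j\<in>K. 2 * t k * (x i / (t i + t k) * (x j / (t j + t k))) +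
      blaschke_weight t k x i * blaschke_weight t k x j / (t i + t j))"
    unfolding cauchy_form_def blaschke_weight_def
    by (intro sum.cong refl schur_term assms)
  also have "\<dots> = 2 * t k * (\<Sum>i\<in>K. x i / (t i + t k))\<^sup>2 + cauchy_form K t (blaschke_weight t k x)"
    unfolding cauchy_form_def power2_eq_square sum_product
    by (simp add: sum.distrib sum_distrib_left)
  finally show ?thesis .
qed

lemma cauchy_form_insert_zero:
  assumes "finite K" "k \<notin> K" "x k = 0"
  shows "cauchy_form (insert k K) t x = cauchy_form K t x"
  using assms by (simp add: cauchy_form_def)

text \<open>The shape used by the inductions: the new weight vanishes at \<open>k\<close>, so the
  remaining form lives on \<open>K\<close>, while the squared sum still ranges over
  \<open>insert k K\<close>.\<close>

lemma cauchy_form_insert: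
  assumes "finite K" "k \<notin> K" "\<And>i. i \<in> insert k K \<Longrightarrow> t i > 0"
  shows "cauchy_form (insert k K) t x =
    2 * t k * (\<Sum>i\<in>insert k K. x i / (t i + t k))\<^sup>2 + cauchy_form K t (blaschke_weight t k x)"
  using cauchy_form_schur[of k "insert k K" t x] assms by (simp add: cauchy_form_insert_zero)

lemma cauchy_form_nonneg:
  assumes "finite K" "\<And>i. i \<in> K \<Longrightarrow> t i > 0"
  shows "cauchy_form K t x \<ge> 0"
  using assms
proof (induction K arbitrary: x rule: finite_induct)
  case empty
  then show ?case by (simp add: cauchy_form_def)
next
  case (insert k K)
  have "0 \<le> 2 * t k * (\<Sum>i\<in>insert k K. x i / (t i + t k))\<^sup>2"
    using insert.prems[of k] by simp
  moreover have "0 \<le> cauchy_form K t (blaschke_weight t k x)"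
    using insert by simp
  moreover have "cauchy_form (insert k K) t x =
      2 * t k * (\<Sum>i\<in>insert k K. x i / (t i + t k))\<^sup>2 + cauchy_form K t (blaschke_weight t k x)"
    by (intro cauchy_form_insert insert.hyps insert.prems)
  ultimately show ?case
    by linarith
qed

lemma pos_semidef_on_Sigma_mat:
  assumes "finite I" "\<And>i. i \<in> I \<Longrightarrow> \<sigma> i > 0"
  shows "pos_semidef_on I (Sigma_mat \<sigma>)"
proof -
  have "inner_on I x (mult_vec_on I (Sigma_mat \<sigma>) x) = cauchy_form I \<sigma> x" for x
    by (simp add: inner_on_def mult_vec_on_def Sigma_mat_def cauchy_form_def sum_distrib_left)
  then show ?thesis
    using cauchy_form_nonneg[of I \<sigma>] assms
    by (auto simp: pos_semidef_on_def Sigma_mat_def add.commute)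
qed

section \<open>From the quadratic form to the transfer functions and back\<close>

text \<open>Partial fractions: the Blaschke factor times the reweighted term has the right principal
  part at the pole of \<open>u / (a * s + 1)\<close>, and the first summand cancels the extra pole
  that the factor brings in. Cleared of denominators, this is \<open>(a + c) * (c * s + 1) = 2 * c *
  (a * s + 1) + (1 - c * s) * (a - c)\<close>.\<close>

lemma blaschke_term:
  fixes a c s u :: "'b::field"
  assumes "a + c \<noteq> 0" "a * s + 1 \<noteq> 0" "c * s + 1 \<noteq> 0"
  shows "u / (a * s + 1) =
    2 * c / (c * s + 1) * (u / (a + c)) +
    (1 - c * s) / (1 + c * s) * (u * (a - c) / (a + c) / (a * s + 1))"
proof -
  have "1 + c * s \<noteq> 0"
    using assms by (simp add: add.commute)
  then show ?thesis
    using assms by (simp add: divide_simps) algebra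
qed

text \<open>
  Stated over a field \<open>'b\<close> to cover both complex \<open>s\<close> and rational functions, where \<open>s\<close> is the
  indeterminate.
\<close>

lemma lag_sum_zero_if_cauchy_form_zero:
  fixes h :: "real \<Rightarrow> 'b::field" and s :: 'b
  assumes h_add: "\<And>u v. h (u + v) = h u + h v"
    and h_mult: "\<And>u v. h (u * v) = h u * h v"
    and h_1: "h 1 = 1"
    and "finite K" "\<And>i. i \<in> K \<Longrightarrow> t i > 0" "\<And>i. i \<in> K \<Longrightarrow> h (t i) * s + 1 \<noteq> 0"
    and "cauchy_form K t x = 0"
  shows "(\<Sum>i\<in>K. h (x i) / (h (t i) * s + 1)) = 0"
  using assms(4-)
proof (induction K arbitrary: x rule: finite_induct)
  case empty
  then show ?case by simp
next
  case (insert k K)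
  \<comment> \<open>The map \<open>h\<close> is a field embedding of the reals. Positivity is argued
    in the reals only; the resulting equations and nonzero denominators are then carried over by
    \<open>h\<close>.\<close>
  have h_0: "h 0 = 0"
    using h_add[of 0 0] by (simp only: add_0_right add_cancel_right_right)
  have h_diff: "h (u - v) = h u - h v" for u v
    using h_add[of "u - v" v] by simp
  have h_nz: "h u \<noteq> 0" if "u \<noteq> 0" for u
    using h_mult[of u "inverse u"] h_1 that by auto
  have h_div: "h (u / v) = h u / h v" if "v \<noteq> 0" for u v
    using h_mult[of "u / v" v] h_nz[OF that] that by (simp add: field_simps)
  have h_sum: "h (sum f A) = (\<Sum>i\<in>A. h (f i))" for f :: "'a \<Rightarrow> real" and A
    by (induction A rule: infinite_finite_induct) (simp_all add: h_0 h_add)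
  let ?y = "blaschke_weight t k x"
  let ?d = "\<Sum>i\<in>insert k K. x i / (t i + t k)"
  have tk: "t k > 0" and y_nonneg: "cauchy_form K t ?y \<ge> 0"
    using insert by (auto intro: cauchy_form_nonneg)
  have "cauchy_form (insert k K) t x = 2 * t k * ?d\<^sup>2 + cauchy_form K t ?y"
    by (intro cauchy_form_insert insert.hyps insert.prems)
  then have "2 * t k * ?d\<^sup>2 + cauchy_form K t ?y = 0"
    using insert.prems(3) by linarith
  moreover have "2 * t k * ?d\<^sup>2 \<ge> 0"
    using tk by (intro mult_nonneg_nonneg) simp_all
  \<comment> \<open>Two nonnegative summands with sum zero both vanish. The first yields
    \<open>?d = 0\<close>, the second is the premise of the induction hypothesis for
    \<open>?y\<close>.\<close>
  ultimately have "2 * t k * ?d\<^sup>2 = 0" and y0: "cauchy_form K t ?y = 0"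
    using y_nonneg by linarith+
  then have d0: "?d = 0"
    using tk by (simp only: mult_eq_0_iff power_eq_0_iff) auto
  have pos: "t i + t k \<noteq> 0" if "i \<in> insert k K" for i
    using insert.prems(1)[OF that] tk by linarith
  have "(\<Sum>i\<in>insert k K. h (x i) / (h (t i) * s + 1)) =
      (\<Sum>i\<in>insert k K. 2 * h (t k) / (h (t k) * s + 1) * h (x i / (t i + t k)) +
        (1 - h (t k) * s) / (1 + h (t k) * s) * (h (?y i) / (h (t i) * s + 1)))"
  proof (rule sum.cong[OF refl])
    fix i assume i: "i \<in> insert k K"
    have "h (t i) + h (t k) \<noteq> 0"
      using h_nz[OF pos[OF i]] by (simp add: h_add)
    then show "h (x i) / (h (t i) * s + 1) =
        2 * h (t k) / (h (t k) * s + 1) * h (x i / (t i + t k)) +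
        (1 - h (t k) * s) / (1 + h (t k) * s) * (h (?y i) / (h (t i) * s + 1))"
      using blaschke_term[of "h (t i)" "h (t k)" s "h (x i)"] insert.prems(2)[of k]
        insert.prems(2)[OF i] pos[OF i]
      by (simp add: blaschke_weight_def h_div h_mult h_add h_diff)
  qed
  also have "\<dots> = 2 * h (t k) / (h (t k) * s + 1) * h ?d +
      (1 - h (t k) * s) / (1 + h (t k) * s) * (\<Sum>i\<in>insert k K. h (?y i) / (h (t i) * s + 1))"
    by (simp only: sum.distrib h_sum sum_distrib_left)
  \<comment> \<open>The term at \<open>k\<close> is zero because \<open>?y k = 0\<close>; the
    induction hypothesis handles the sum over \<open>K\<close>.\<close>
  also have "(\<Sum>i\<in>insert k K. h (?y i) / (h (t i) * s + 1)) = 0"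
    using insert.IH[of ?y] insert.hyps insert.prems y0 by (simp add: h_0)
  finally show ?case
    by (simp only: d0 h_0 mult_zero_right add_0_right)
qed

text \<open>The kernel \<open>1 / (t k + t i)\<close> is \<open>1 / t k\<close> times the lag
  \<open>1 / (t i * r + 1)\<close> at \<open>r = 1 / t k\<close>. Asking only for positive
  \<open>r\<close> keeps clear of poles, so both readings of the identity can supply the
  hypothesis.\<close>

lemma cauchy_form_zero_if_lag_sum_zero:
  assumes "\<And>i. i \<in> K \<Longrightarrow> t i > 0"
    and "\<And>r. r > 0 \<Longrightarrow> (\<Sum>i\<in>K. x i / (t i * r + 1)) = 0"
  shows "cauchy_form K t x = 0"
proof -
  have "cauchy_form K t x = (\<Sum>k\<in>K. x k / t k * (\<Sum>i\<in>K. x i / (t i * (1 / t k) + 1)))"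
    unfolding cauchy_form_def sum_distrib_left
  proof (intro sum.cong refl)
    fix k i assume "k \<in> K" "i \<in> K"
    then have "t k > 0" "t i > 0"
      using assms(1) by auto
    then show "x k * x i / (t k + t i) = x k / t k * (x i / (t i * (1 / t k) + 1))"
      by (simp add: field_simps)
  qed
  also have "\<dots> = 0"
    using assms(1) by (intro sum.neutral ballI) (simp del: times_divide_eq_right add: assms(2))
  finally show ?thesis .
qed

section \<open>Evaluating rational functions at a point\<close>

text \<open>A fraction may have representatives whose denominator vanishes at \<open>r\<close>, so
  its value is read off from one that is regular there. Such representatives are closed under
  addition, since a product of nonzero values is nonzero.\<close>

lemma sum_Fract_eval:
  fixes p q :: "'a \<Rightarrow> 'b::field poly"
  assumes "finite A" "\<And>i. i \<in> A \<Longrightarrow> poly (q i) r \<noteq> 0"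
  shows "\<exists>N D. poly D r \<noteq> 0 \<and> (\<Sum>i\<in>A. Fract (p i) (q i)) = Fract N D \<and>
    poly N r / poly D r = (\<Sum>i\<in>A. poly (p i) r / poly (q i) r)"
  using assms
proof (induction A rule: finite_induct)
  case empty
  have "poly (1::'b poly) r \<noteq> 0 \<and> (0::'b poly fract) = Fract 0 1"
    by (simp add: Zero_fract_def)
  then show ?case
    by (intro exI[of _ 0] exI[of _ 1]) simp
next
  case (insert k A)
  then obtain N D where ND: "poly D r \<noteq> 0" "(\<Sum>i\<in>A. Fract (p i) (q i)) = Fract N D"
    "poly N r / poly D r = (\<Sum>i\<in>A. poly (p i) r / poly (q i) r)"
    by auto
  have qk: "poly (q k) r \<noteq> 0"
    using insert by auto
  have "q k \<noteq> 0" "D \<noteq> 0"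
    using qk ND(1) by auto
  then have "(\<Sum>i\<in>insert k A. Fract (p i) (q i)) = Fract (p k * D + N * q k) (q k * D)"
    using insert ND(2) by simp
  moreover have "poly (p k * D + N * q k) r / poly (q k * D) r =
      (\<Sum>i\<in>insert k A. poly (p i) r / poly (q i) r)"
    using insert.hyps ND(1) qk by (simp add: ND(3)[symmetric] add_divide_distrib)
  moreover have "poly (q k * D) r \<noteq> 0"
    using qk ND(1) by simp
  ultimately show ?case
    by blast
qed

text \<open>Well-definedness of evaluation: the cross-multiplied polynomial equation is evaluated at
  \<open>r\<close> and divided by the nonzero values.\<close>

lemma Fract_eq_eval:
  fixes N D N' D' :: "'b::field poly"
  assumes "Fract N D = Fract N' D'" "poly D r \<noteq> 0" "poly D' r \<noteq> 0"
  shows "poly N r / poly D r = poly N' r / poly D' r"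
proof -
  have "D \<noteq> 0" "D' \<noteq> 0"
    using assms by auto
  then have "N * D' = N' * D"
    using assms(1) by (simp add: eq_fract)
  then have "poly N r * poly D' r = poly N' r * poly D r"
    by (metis poly_mult)
  then show ?thesis
    using assms by (simp add: field_simps)
qed

lemma lag_sum_fract_eq_imp_eval:
  fixes A B :: "'a set"
  assumes "finite A" "finite B" "\<And>i. i \<in> A \<Longrightarrow> t i * r + 1 \<noteq> 0" "\<And>i. i \<in> B \<Longrightarrow> u i * r + 1 \<noteq> 0"
    and "lag_sum_fract A k t = lag_sum_fract B l u"
  shows "(\<Sum>i\<in>A. k i / (t i * r + 1)) = (\<Sum>i\<in>B. l i / (u i * r + 1))"
proof -
  have ev: "\<exists>N D. poly D r \<noteq> 0 \<and> lag_sum_fract C m v = Fract N D \<and>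
      poly N r / poly D r = (\<Sum>i\<in>C. m i / (v i * r + 1))"
    if "finite C" "\<And>i. i \<in> C \<Longrightarrow> v i * r + 1 \<noteq> 0" for C :: "'a set" and m v
    using sum_Fract_eval[of C "\<lambda>i. [:1, v i:]" r "\<lambda>i. [:m i:]"] that
    by (simp add: lag_sum_fract_def algebra_simps)
  obtain N D where ND: "poly D r \<noteq> 0" "lag_sum_fract A k t = Fract N D"
    "poly N r / poly D r = (\<Sum>i\<in>A. k i / (t i * r + 1))"
    using ev[of A t k] assms by blast
  obtain N' D' where ND': "poly D' r \<noteq> 0" "lag_sum_fract B l u = Fract N' D'"
    "poly N' r / poly D' r = (\<Sum>i\<in>B. l i / (u i * r + 1))"
    using ev[of B u l] assms by blast
  show ?thesis
    using Fract_eq_eval[of N D N' D' r] ND ND' assms(5) by simp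
qed

text \<open>Puts a lag into the form \<open>h k / (h t * s + 1)\<close> over the field of fractions,
  with \<open>h c = Fract [:c:] 1\<close> and the indeterminate
  \<open>s = Fract [:0, 1:] 1\<close>.\<close>

lemma Fract_lag_eq:
  fixes k t :: "'b::field"
  shows "Fract [:k:] [:1, t:] = Fract [:k:] 1 / (Fract [:t:] 1 * Fract [:0, 1:] 1 + 1)"
    and "Fract [:t:] 1 * Fract [:0, 1:] 1 + 1 \<noteq> 0"
proof -
  have eq: "Fract [:t:] 1 * Fract [:0, 1:] 1 + 1 = Fract [:1, t:] 1"
    by (simp add: One_fract_def one_pCons)
  show "Fract [:k:] [:1, t:] = Fract [:k:] 1 / (Fract [:t:] 1 * Fract [:0, 1:] 1 + 1)"
    unfolding eq by simp
  show "Fract [:t:] 1 * Fract [:0, 1:] 1 + 1 \<noteq> 0"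
    unfolding eq by (simp add: Zero_fract_def eq_fract)
qed

section \<open>The identity as one of rational functions and as one of complex values\<close>

theorem theorem2:
  fixes G I :: "'a set" and \<alpha> \<tau> \<rho> \<sigma> :: "'a \<Rightarrow> real"
  assumes "finite G" and "finite I" and "G \<inter> I = {}"
    and "\<And>i. i \<in> G \<Longrightarrow> \<alpha> i > 0" and "\<And>i. i \<in> G \<Longrightarrow> \<tau> i > 0"
    and "\<And>i. i \<in> I \<Longrightarrow> \<rho> i \<ge> 0" and "\<And>i. i \<in> I \<Longrightarrow> \<sigma> i > 0"
  shows "pos_semidef_on I (Sigma_mat \<sigma>) \<and>
    (lag_sum_fract I \<rho> \<sigma> = lag_sum_fract G \<alpha> \<tau> \<longleftrightarrow>
      inner_on I \<rho> (mult_vec_on I (Sigma_mat \<sigma>) \<rho>) + inner_on I (b_vec G \<alpha> \<tau> \<sigma>) \<rho> + c_const G \<alpha> \<tau> = 0) \<and>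
    ((\<forall>s. no_pole I \<sigma> s \<and> no_pole G \<tau> s \<longrightarrow> lag_sum I \<rho> \<sigma> s = lag_sum G \<alpha> \<tau> s) \<longleftrightarrow>
      inner_on I \<rho> (mult_vec_on I (Sigma_mat \<sigma>) \<rho>) + inner_on I (b_vec G \<alpha> \<tau> \<sigma>) \<rho> + c_const G \<alpha> \<tau> = 0)"
proof -
  let ?K = "I \<union> G"
  define x where "x i = (if i \<in> I then \<rho> i else - \<alpha> i)" for i
  define t where "t i = (if i \<in> I then \<sigma> i else \<tau> i)" for i
  have on_I: "x i = \<rho> i" "t i = \<sigma> i" if "i \<in> I" for i
    using that by (auto simp: x_def t_def)
  have on_G: "x i = - \<alpha> i" "t i = \<tau> i" if "i \<in> G" for i
    using that assms(3) by (auto simp: x_def t_def)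
  have finK: "finite ?K" and tpos: "\<And>i. i \<in> ?K \<Longrightarrow> t i > 0"
    using assms(1,2,5,7) by (auto simp: on_I on_G)
  have split: "sum f ?K = sum f I + sum f G" for f :: "'a \<Rightarrow> 'b::comm_monoid_add"
    using assms(1-3) by (intro sum.union_disjoint) auto

  have "cauchy_form ?K t x =
      (\<Sum>i\<in>I. \<Sum>j\<in>I. \<rho> i * \<rho> j / (\<sigma> i + \<sigma> j)) - (\<Sum>i\<in>I. \<Sum>j\<in>G. \<rho> i * \<alpha> j / (\<sigma> i + \<tau> j))
      - (\<Sum>i\<in>G. \<Sum>j\<in>I. \<alpha> i * \<rho> j / (\<tau> i + \<sigma> j)) + c_const G \<alpha> \<tau>"
    by (simp add: cauchy_form_def c_const_def split on_I on_G sum.distrib sum_subtractf sum_negf)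
  \<comment> \<open>The two mixed blocks coincide after swapping the sums, which accounts for the
    factor \<open>- 2\<close> in \<open>b_vec\<close>.\<close>
  also have "(\<Sum>i\<in>G. \<Sum>j\<in>I. \<alpha> i * \<rho> j / (\<tau> i + \<sigma> j)) = (\<Sum>i\<in>I. \<Sum>j\<in>G. \<rho> i * \<alpha> j / (\<sigma> i + \<tau> j))"
    by (subst sum.swap) (simp add: mult.commute add.commute)
  finally have Q: "inner_on I \<rho> (mult_vec_on I (Sigma_mat \<sigma>) \<rho>) + inner_on I (b_vec G \<alpha> \<tau> \<sigma>) \<rho>
      + c_const G \<alpha> \<tau> = cauchy_form ?K t x"
    by (simp add: inner_on_def mult_vec_on_def Sigma_mat_def b_vec_def sum_distrib_left
        sum_distrib_right sum_negf mult_ac)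

  \<comment> \<open>Both forward implications pass through this: agreement at positive reals, where
    positive time constants exclude poles, is enough.\<close>
  have real: "cauchy_form ?K t x = 0"
    if "\<And>r. r > 0 \<Longrightarrow> (\<Sum>i\<in>I. \<rho> i / (\<sigma> i * r + 1)) = (\<Sum>i\<in>G. \<alpha> i / (\<tau> i * r + 1))"
    using that tpos
    by (intro cauchy_form_zero_if_lag_sum_zero) (simp_all add: split on_I on_G sum_negf)

  have nonzero: "a * r + 1 \<noteq> 0" if "a > 0" "r > 0" for a r :: real
    using mult_pos_pos[OF that] by linarith

  have fract: "lag_sum_fract I \<rho> \<sigma> = lag_sum_fract G \<alpha> \<tau> \<longleftrightarrow> cauchy_form ?K t x = 0"
  proof
    assume "lag_sum_fract I \<rho> \<sigma> = lag_sum_fract G \<alpha> \<tau>"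
    then show "cauchy_form ?K t x = 0"
      using assms(1,2,5,7) by (intro real lag_sum_fract_eq_imp_eval nonzero)
  next
    assume "cauchy_form ?K t x = 0"
    moreover have "Fract [:u * v:] 1 = Fract [:u:] 1 * Fract [:v:] 1" for u v :: real
      by (simp add: mult.commute)
    \<comment> \<open>At the indeterminate no denominator is zero, so there are no poles to
      exclude.\<close>
    ultimately have "(\<Sum>i\<in>?K. Fract [:x i:] 1 / (Fract [:t i:] 1 * Fract [:0, 1:] 1 + 1)) = 0"
      using finK tpos
      by (intro lag_sum_zero_if_cauchy_form_zero[where h = "\<lambda>c. Fract [:c:] 1"] Fract_lag_eq(2))
        (simp_all add: One_fract_def one_pCons)
    then have "(\<Sum>i\<in>?K. Fract [:x i:] [:1, t i:]) = 0"
      by (simp only: Fract_lag_eq(1))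
    moreover have "Fract [:- c:] q = - Fract [:c:] q" for c :: real and q
      using minus_fract[of "[:c:]" q] by simp
    ultimately show "lag_sum_fract I \<rho> \<sigma> = lag_sum_fract G \<alpha> \<tau>"
      by (simp add: split on_I on_G sum_negf lag_sum_fract_def del: minus_fract)
  qed

  have "(\<forall>s. no_pole I \<sigma> s \<and> no_pole G \<tau> s \<longrightarrow> lag_sum I \<rho> \<sigma> s = lag_sum G \<alpha> \<tau> s) \<longleftrightarrow>
      cauchy_form ?K t x = 0"
  proof
    assume H: "\<forall>s. no_pole I \<sigma> s \<and> no_pole G \<tau> s \<longrightarrow> lag_sum I \<rho> \<sigma> s = lag_sum G \<alpha> \<tau> s"
    have lag_of_real: "lag_sum A k u (of_real r) = of_real (\<Sum>i\<in>A. k i / (u i * r + 1))"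
      for A :: "'a set" and k u r
      by (simp add: lag_sum_def)
    have no_pole_of_real: "no_pole A u (of_real r)"
      if "r > 0" "\<And>i. i \<in> A \<Longrightarrow> u i > 0" for A :: "'a set" and u r
      unfolding no_pole_def
    proof
      fix i assume "i \<in> A"
      then have "u i * r + 1 \<noteq> 0"
        using that nonzero by blast
      then show "of_real (u i) * of_real r + 1 \<noteq> (0::complex)"
        by (metis of_real_1 of_real_add of_real_eq_0_iff of_real_mult)
    qed
    show "cauchy_form ?K t x = 0"
    proof (rule real)
      fix r :: real assume "r > 0"
      then have "lag_sum I \<rho> \<sigma> (of_real r) = lag_sum G \<alpha> \<tau> (of_real r)"
        using H no_pole_of_real assms(5,7) by blast
      then show "(\<Sum>i\<in>I. \<rho> i / (\<sigma> i * r + 1)) = (\<Sum>i\<in>G. \<alpha> i / (\<tau> i * r + 1))"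
        unfolding lag_of_real of_real_eq_iff .
    qed
  next
    assume Q0: "cauchy_form ?K t x = 0"
    show "\<forall>s. no_pole I \<sigma> s \<and> no_pole G \<tau> s \<longrightarrow> lag_sum I \<rho> \<sigma> s = lag_sum G \<alpha> \<tau> s"
    proof (intro allI impI)
      fix s assume "no_pole I \<sigma> s \<and> no_pole G \<tau> s"
      then have "of_real (t i) * s + 1 \<noteq> 0" if "i \<in> ?K" for i
        using that by (auto simp: no_pole_def on_I on_G)
      \<comment> \<open>Here \<open>h\<close> is \<open>of_real\<close> into the complex numbers,
        and the absence of poles at \<open>s\<close> gives the nonzero denominators.\<close>
      then have "(\<Sum>i\<in>?K. of_real (x i) / (of_real (t i) * s + 1)) = 0"
        using finK tpos Q0 by (intro lag_sum_zero_if_cauchy_form_zero) simp_all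
      then show "lag_sum I \<rho> \<sigma> s = lag_sum G \<alpha> \<tau> s"
        by (simp add: split on_I on_G sum_negf lag_sum_def)
    qed
  qed
  then show ?thesis
    unfolding Q using fract pos_semidef_on_Sigma_mat[of I \<sigma>] assms(2,7) by blast
qed

end
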